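(* Let $\mathbb{F}\in\{\mathbb{R},\mathbb{C},\mathbb{H}\}$, let $G\subset \mathrm{GL}(\mathbb{F}^2)$ be a unitary group of matrices, and let $S$ be a set of generators for $G$. Let $q\in\mathbb{H}$. The orthogonal system given by $(1,q)$ is a system of imprimitivity for $G$ (viewed as a group of matrices over $\mathbb{H}$) if and only if for every generator $$g=\begin{pmatrix}a&b\\ c&d\end{pmatrix}\in S,$$ (at least) one of the following two equations holds: $$a+bq+\overline{q}c+\overline{q}dq=0,\qquad qa+qbq-c-dq=0.$$
   Context: $\mathbb{H}$ denotes the quaternions, $\mathbb{H}^2$ is a right vector space over $\mathbb{H}$ (matrices act on the left), with inner product $\langle v,w\rangle=\sum_j\overline{v_j}w_j$. Matrices over $\mathbb{R}$ or $\mathbb{C}$ are viewed as matrices over $\mathbb{H}$. The orthogonal system given by $(1,q)$ is the pair of one-dimensional subspaces of $\mathbb{H}^2$ spanned by $(1,q)$ and by $(-\overline{q},1)$ (its orthogonal complement). A pair $V_1,V_2$ of one-dimensional subspaces with $\mathbb{H}^2=V_1\oplus V_2$ is a system of imprimitivity for $G$ if every element of $G$ permutes $V_1,V_2$ (i.e. maps $\{V_1,V_2\}$ to itself). *)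

theory Defs
  imports "HOL-Analysis.Analysis" "HOL-Algebra.Generated_Groups"
begin

datatype quat = Quat (qre: real) (qi: real) (qj: real) (qk: real)

lemma quat_eq_iff: "x = y \<longleftrightarrow> qre x = qre y \<and> qi x = qi y \<and> qj x = qj y \<and> qk x = qk y"
  by (cases x; cases y) auto

text \<open>Multiplication is determined by $i^2 = j^2 = k^2 = ijk = -1$.\<close>

instantiation quat :: real_div_algebra
begin

definition zero_quat :: quat where "zero_quat = Quat 0 0 0 0"

definition one_quat :: quat where "one_quat = Quat 1 0 0 0"

definition plus_quat :: "quat \<Rightarrow> quat \<Rightarrow> quat" where
  "plus_quat x y = Quat (qre x + qre y) (qi x + qi y) (qj x + qj y) (qk x + qk y)"

definition uminus_quat :: "quat \<Rightarrow> quat" where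
  "uminus_quat x = Quat (- qre x) (- qi x) (- qj x) (- qk x)"

definition minus_quat :: "quat \<Rightarrow> quat \<Rightarrow> quat" where
  "minus_quat x y = Quat (qre x - qre y) (qi x - qi y) (qj x - qj y) (qk x - qk y)"

definition times_quat :: "quat \<Rightarrow> quat \<Rightarrow> quat" where
  "times_quat x y = Quat
     (qre x * qre y - qi x * qi y - qj x * qj y - qk x * qk y)
     (qre x * qi y + qi x * qre y + qj x * qk y - qk x * qj y)
     (qre x * qj y - qi x * qk y + qj x * qre y + qk x * qi y)
     (qre x * qk y + qi x * qj y - qj x * qi y + qk x * qre y)"

definition scaleR_quat :: "real \<Rightarrow> quat \<Rightarrow> quat" where
  "scaleR_quat r x = Quat (r * qre x) (r * qi x) (r * qj x) (r * qk x)"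

definition inverse_quat :: "quat \<Rightarrow> quat" where
  "inverse_quat x = (let n = (qre x)\<^sup>2 + (qi x)\<^sup>2 + (qj x)\<^sup>2 + (qk x)\<^sup>2
     in Quat (qre x / n) (- qi x / n) (- qj x / n) (- qk x / n))"

definition divide_quat :: "quat \<Rightarrow> quat \<Rightarrow> quat" where
  "divide_quat x y = x * inverse y"

lemmas quat_ops_defs = zero_quat_def one_quat_def plus_quat_def uminus_quat_def minus_quat_def
  times_quat_def scaleR_quat_def

instance
proof
  fix x y z :: quat and r s :: real
  show "x * y * z = x * (y * z)" by (simp add: quat_ops_defs algebra_simps)
  show "(x + y) * z = x * z + y * z" by (simp add: quat_ops_defs algebra_simps)
  show "x * (y + z) = x * y + x * z" by (simp add: quat_ops_defs algebra_simps)
  show "inverse x * x = 1" "x * inverse x = 1" if "x \<noteq> 0"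
  proof -
    define n where "n = (qre x)\<^sup>2 + (qi x)\<^sup>2 + (qj x)\<^sup>2 + (qk x)\<^sup>2"
    have "n \<noteq> 0"
      using that by (auto simp: n_def quat_eq_iff zero_quat_def add_nonneg_eq_0_iff)
    moreover have "inverse x = Quat (qre x / n) (- qi x / n) (- qj x / n) (- qk x / n)"
      by (simp add: inverse_quat_def n_def Let_def)
    moreover have "qre x * qre x + qi x * qi x + qj x * qj x + qk x * qk x = n"
      by (simp add: n_def power2_eq_square)
    ultimately show "inverse x * x = 1" "x * inverse x = 1"
      by (simp_all add: quat_ops_defs field_simps)
  qed
  show "inverse 0 = (0::quat)" by (simp add: inverse_quat_def zero_quat_def)
qed (simp_all add: quat_ops_defs divide_quat_def algebra_simps quat_eq_iff)

end

lemma quat_sel_simps [simp]: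
  "qre 0 = 0" "qi 0 = 0" "qj 0 = 0" "qk 0 = 0"
  "qre 1 = 1" "qi 1 = 0" "qj 1 = 0" "qk 1 = 0"
  "qre (x + y) = qre x + qre y" "qi (x + y) = qi x + qi y"
  "qj (x + y) = qj x + qj y" "qk (x + y) = qk x + qk y"
  "qre (- x) = - qre x" "qi (- x) = - qi x" "qj (- x) = - qj x" "qk (- x) = - qk x"
  "qre (x - y) = qre x - qre y" "qi (x - y) = qi x - qi y"
  "qj (x - y) = qj x - qj y" "qk (x - y) = qk x - qk y"
  "qre (r *\<^sub>R x) = r * qre x" "qi (r *\<^sub>R x) = r * qi x"
  "qj (r *\<^sub>R x) = r * qj x" "qk (r *\<^sub>R x) = r * qk x"
  by (simp_all add: quat_ops_defs)

lemma quat_mult_sel: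
  "qre (x * y) = qre x * qre y - qi x * qi y - qj x * qj y - qk x * qk y"
  "qi (x * y) = qre x * qi y + qi x * qre y + qj x * qk y - qk x * qj y"
  "qj (x * y) = qre x * qj y - qi x * qk y + qj x * qre y + qk x * qi y"
  "qk (x * y) = qre x * qk y + qi x * qj y - qj x * qi y + qk x * qre y"
  by (simp_all add: times_quat_def)

definition qcnj :: "quat \<Rightarrow> quat" where
  "qcnj x = Quat (qre x) (- qi x) (- qj x) (- qk x)"

definition quat_of_complex :: "complex \<Rightarrow> quat" where
  "quat_of_complex z = Quat (Re z) (Im z) 0 0"

lemma quat_of_complex_hom:
  "quat_of_complex 0 = 0" "quat_of_complex 1 = 1"
  "quat_of_complex (z + w) = quat_of_complex z + quat_of_complex w"
  "quat_of_complex (z * w) = quat_of_complex z * quat_of_complex w"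
  by (simp_all add: quat_of_complex_def quat_eq_iff quat_mult_sel)

definition right_scale :: "quat^2 \<Rightarrow> quat \<Rightarrow> quat^2" where
  "right_scale v t = (\<chi> i. v $ i * t)"

definition right_span :: "quat^2 \<Rightarrow> (quat^2) set" where
  "right_span v = range (right_scale v)"

definition one_dim :: "(quat^2) set \<Rightarrow> bool" where
  "one_dim V \<longleftrightarrow> (\<exists>v. v \<noteq> 0 \<and> V = right_span v)"

definition qinner :: "quat^2 \<Rightarrow> quat^2 \<Rightarrow> quat" where
  "qinner v w = (\<Sum>j\<in>UNIV. qcnj (v $ j) * w $ j)"

lemma right_span_orth_complement:
  "right_span (vector [- qcnj q, 1]) = {w. \<forall>v \<in> right_span (vector [1, q]). qinner v w = 0}"
proof (intro subset_antisym subsetI)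
  fix w assume "w \<in> right_span (vector [- qcnj q, 1])"
  then show "w \<in> {w. \<forall>v \<in> right_span (vector [1, q]). qinner v w = 0}"
    by (auto simp: right_span_def right_scale_def qinner_def sum_2 qcnj_def quat_eq_iff
        quat_mult_sel algebra_simps)
next
  fix w assume "w \<in> {w. \<forall>v \<in> right_span (vector [1, q]). qinner v w = 0}"
  moreover have "vector [1, q] \<in> right_span (vector [1, q])"
    unfolding right_span_def
    by (rule range_eqI [of _ _ 1]) (simp add: right_scale_def vec_eq_iff)
  ultimately have "qinner (vector [1, q]) w = 0" by blast
  moreover have "qcnj 1 = 1" by (simp add: qcnj_def quat_eq_iff)
  ultimately have "w $ 1 + qcnj q * w $ 2 = 0"
    by (simp add: qinner_def sum_2)
  then have "w = right_scale (vector [- qcnj q, 1]) (w $ 2)"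
    by (simp add: right_scale_def vec_eq_iff forall_2 eq_neg_iff_add_eq_0)
  then show "w \<in> right_span (vector [- qcnj q, 1])"
    unfolding right_span_def by blast
qed

text \<open>\<open>F\<close> is a subring of the quaternions, so that its matrices are quaternionic matrices
  from the start; the inverse matrix is required to have entries in \<open>F\<close> as well.\<close>

definition GL2 :: "quat set \<Rightarrow> (quat^2^2) monoid" where
  "GL2 F = \<lparr>carrier = {A. (\<forall>i j. A $ i $ j \<in> F) \<and>
                (\<exists>B. (\<forall>i j. B $ i $ j \<in> F) \<and> A ** B = mat 1 \<and> B ** A = mat 1)},
            monoid.mult = (**), one = mat 1\<rparr>"

lemma group_GL2:
  assumes "F \<in> {\<real>, range quat_of_complex, UNIV}"
  shows "group (GL2 F)"
proof -
  have F: "0 \<in> F" "1 \<in> F"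
    using assms rangeI [of quat_of_complex 0] rangeI [of quat_of_complex 1]
    by (auto simp: quat_of_complex_hom(1,2))
  have F2: "x + y \<in> F" "x * y \<in> F" if "x \<in> F" "y \<in> F" for x y
    using assms that
    by (auto simp flip: quat_of_complex_hom(3,4))
  have cl: "\<forall>i j. (A ** B) $ i $ j \<in> F"
    if "\<forall>i j. A $ i $ j \<in> F" "\<forall>i j. B $ i $ j \<in> F" for A B :: "quat^2^2"
    using that F2 by (simp add: matrix_matrix_mult_def sum_2)
  have one: "\<forall>i j. (mat 1 :: quat^2^2) $ i $ j \<in> F"
    using F by (simp add: mat_def)
  show ?thesis
  proof (rule groupI)
    fix A B assume A: "A \<in> carrier (GL2 F)" and B: "B \<in> carrier (GL2 F)"
    then obtain A' B' where *: "\<forall>i j. A' $ i $ j \<in> F" "A ** A' = mat 1" "A' ** A = mat 1"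
      "\<forall>i j. B' $ i $ j \<in> F" "B ** B' = mat 1" "B' ** B = mat 1"
      by (auto simp: GL2_def)
    have "(A ** B) ** (B' ** A') = mat 1" "(B' ** A') ** (A ** B) = mat 1"
      using * by (metis matrix_mul_assoc matrix_mul_lid)+
    with A B * show "A \<otimes>\<^bsub>GL2 F\<^esub> B \<in> carrier (GL2 F)"
      by (auto simp: GL2_def intro!: cl [rule_format] exI [of _ "B' ** A'"])
  next
    show "\<one>\<^bsub>GL2 F\<^esub> \<in> carrier (GL2 F)"
      using one by (auto simp: GL2_def intro!: exI [of _ "mat 1"])
  next
    fix A assume "A \<in> carrier (GL2 F)"
    then show "\<exists>B\<in>carrier (GL2 F). B \<otimes>\<^bsub>GL2 F\<^esub> A = \<one>\<^bsub>GL2 F\<^esub>"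
      by (auto simp: GL2_def)
  qed (simp_all add: GL2_def matrix_mul_assoc)
qed

definition unitary :: "quat^2^2 \<Rightarrow> bool" where
  "unitary A \<longleftrightarrow> (\<forall>v w. qinner (A *v v) (A *v w) = qinner v w)"

definition system_of_imprimitivity ::
  "(quat^2^2) set \<Rightarrow> (quat^2) set \<Rightarrow> (quat^2) set \<Rightarrow> bool" where
  "system_of_imprimitivity G V\<^sub>1 V\<^sub>2 \<longleftrightarrow>
     one_dim V\<^sub>1 \<and> one_dim V\<^sub>2 \<and>
     V\<^sub>1 \<inter> V\<^sub>2 = {0} \<and> {v + w | v w. v \<in> V\<^sub>1 \<and> w \<in> V\<^sub>2} = UNIV \<and>
     (\<forall>g\<in>G. {(*v) g ` V\<^sub>1, (*v) g ` V\<^sub>2} = {V\<^sub>1, V\<^sub>2})"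

end

theory Submission
  imports Defs
begin

text \<open>
  Put \<open>v = (1, q)\<close> and \<open>w = (- qcnj q, 1)\<close>, and let \<open>V\<^sub>1\<close>, \<open>V\<^sub>2\<close> be the lines they span.
  Each line is the orthogonal complement of the other, and \<open>g v = (a + b q, c + d q)\<close> for a matrix
  \<open>g\<close> with rows \<open>(a, b)\<close> and \<open>(c, d)\<close>. Hence the first equation is \<open>\<langle>v, g v\<rangle> = 0\<close>, which
  says \<open>g v \<in> V\<^sub>2\<close>, and the second one is, up to sign, \<open>\<langle>w, g v\<rangle> = 0\<close>, which says
  \<open>g v \<in> V\<^sub>1\<close>. So the equations only control the image of \<open>V\<^sub>1\<close>. For an invertible
  unitary \<open>g\<close> this is enough: if \<open>g\<close> maps \<open>V\<^sub>1\<close> into one of the two lines, it maps \<open>V\<^sub>1\<close>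
  onto it, because a line is spanned by any of its nonzero vectors, and since \<open>g\<close> commutes with
  orthogonal complements it maps \<open>V\<^sub>2\<close> onto the other one. This is
  \<open>unitary_permutes_orthogonal_pair_iff\<close>.

  The passage from generators to the group is formal: the elements of a matrix group
  that permute a given family of subsets form a subgroup, so \<open>G\<close> permutes the two lines as soon as
  \<open>S\<close> does (\<open>generate_permutes\<close>). That the two lines are complementary is true for every \<open>q\<close>,
  because \<open>1 + |q|\<^sup>2\<close> is a nonzero real number.
\<close>

section \<open>Conjugation and the inner product\<close>

lemma qcnj_simps [simp]:
  "qcnj (- x) = - qcnj x" "qcnj (qcnj x) = x" "qcnj 1 = 1"
  by (simp_all add: qcnj_def quat_eq_iff)

lemma qcnj_mult: "qcnj (x * y) = qcnj y * qcnj x"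
  by (simp add: qcnj_def quat_eq_iff quat_mult_sel algebra_simps)

lemma qcnj_mult_self: "qcnj x * x = ((qre x)\<^sup>2 + (qi x)\<^sup>2 + (qj x)\<^sup>2 + (qk x)\<^sup>2) *\<^sub>R 1"
  and mult_qcnj_self: "x * qcnj x = ((qre x)\<^sup>2 + (qi x)\<^sup>2 + (qj x)\<^sup>2 + (qk x)\<^sup>2) *\<^sub>R 1"
  by (simp_all add: qcnj_def quat_eq_iff quat_mult_sel power2_eq_square algebra_simps)

lemma qcnj_eq_0_iff [simp]: "qcnj x = 0 \<longleftrightarrow> x = 0"
  by (auto simp: qcnj_def quat_eq_iff)

lemma qinner_right_scale_left: "qinner (right_scale u t) w = qcnj t * qinner u w"
  by (simp add: qinner_def right_scale_def qcnj_mult sum_distrib_left mult.assoc)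

section \<open>Lines spanned by a vector\<close>

lemma right_scale_right_scale: "right_scale (right_scale u s) t = right_scale u (s * t)"
  by (simp add: right_scale_def vec_eq_iff mult.assoc)

lemma right_span_base: "u \<in> right_span u"
  unfolding right_span_def by (rule range_eqI [of _ _ 1]) (simp add: right_scale_def vec_eq_iff)

text \<open>A scalar \<open>s\<close> with \<open>u = v s\<close> is nonzero, so it can be divided out.\<close>

lemma right_span_eqI:
  assumes "u \<in> right_span v" "u \<noteq> 0"
  shows "right_span u = right_span v"
proof -
  obtain s where u: "u = right_scale v s"
    using assms by (auto simp: right_span_def)
  with assms have "s \<noteq> 0" by (auto simp: right_scale_def vec_eq_iff)
  then have "t = s * (inverse s * t)" for t
    by (simp flip: mult.assoc)
  then have "right_scale v t = right_scale u (inverse s * t)" for t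
    by (simp add: u right_scale_right_scale)
  then have "right_span v \<subseteq> right_span u"
    unfolding right_span_def by blast
  moreover have "right_span u \<subseteq> right_span v"
    by (auto simp: right_span_def u right_scale_right_scale)
  ultimately show ?thesis by simp
qed

lemma matrix_vector_right_scale: "g *v right_scale u t = right_scale (g *v u) t"
  by (simp add: right_scale_def vec_eq_iff matrix_vector_mult_def sum_distrib_right mult.assoc)

lemma image_right_span: "(*v) g ` right_span u = right_span (g *v u)"
  by (simp add: right_span_def image_image matrix_vector_right_scale)

section \<open>Orthogonal complements\<close>

definition orth_compl :: "(quat^2) set \<Rightarrow> (quat^2) set" where
  "orth_compl X = {w. \<forall>v\<in>X. qinner v w = 0}"

lemma mem_orth_compl_right_span: "w \<in> orth_compl (right_span u) \<longleftrightarrow> qinner u w = 0"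
  using right_span_base [of u]
  by (auto simp: orth_compl_def right_span_def qinner_right_scale_left)

text \<open>Preservation of the inner product gives the inclusion from left to right; for the converse,
  a vector orthogonal to the image of \<open>X\<close> is pulled back along \<open>h\<close>.\<close>

lemma unitary_image_orth_compl:
  assumes "unitary g" and "g ** h = mat 1"
  shows "(*v) g ` orth_compl X = orth_compl ((*v) g ` X)"
proof (intro subset_antisym subsetI)
  fix y assume y: "y \<in> orth_compl ((*v) g ` X)"
  have yh: "y = g *v (h *v y)"
    using assms by (simp add: matrix_vector_mul_assoc)
  have "qinner v (h *v y) = 0" if "v \<in> X" for v
  proof -
    have "qinner v (h *v y) = qinner (g *v v) (g *v (h *v y))"
      using assms(1) by (simp only: unitary_def)
    also have "\<dots> = 0"
      using y that unfolding yh [symmetric] orth_compl_def by blast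
    finally show ?thesis .
  qed
  then have "h *v y \<in> orth_compl X" by (simp add: orth_compl_def)
  with yh show "y \<in> (*v) g ` orth_compl X" by blast
qed (use assms(1) in \<open>auto simp: orth_compl_def unitary_def\<close>)

text \<open>Since \<open>g\<close> is injective, the image of the first line is again a line; so it lies in one of the
  two lines only if it is that line. Complementation then forces the image of the second line.\<close>

lemma unitary_permutes_orthogonal_pair_iff:
  assumes g: "unitary g" "g ** h = mat 1" "h ** g = mat 1" and "u \<noteq> 0"
    and compl: "right_span w = orth_compl (right_span u)" "right_span u = orth_compl (right_span w)"
  shows "(`) ((*v) g) ` {right_span u, right_span w} = {right_span u, right_span w} \<longleftrightarrow>
         qinner u (g *v u) = 0 \<or> qinner w (g *v u) = 0"
proof -
  have mem: "g *v u \<in> right_span w \<longleftrightarrow> qinner u (g *v u) = 0"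
            "g *v u \<in> right_span u \<longleftrightarrow> qinner w (g *v u) = 0"
    using compl mem_orth_compl_right_span by metis+
  have img: "(*v) g ` right_span w = orth_compl (right_span (g *v u))"
    using unitary_image_orth_compl [OF g(1,2), of "right_span u"]
    by (simp add: compl(1) image_right_span)
  have "h *v (g *v u) = u"
    using g(3) by (simp add: matrix_vector_mul_assoc)
  with \<open>u \<noteq> 0\<close> have nz: "g *v u \<noteq> 0"
    by (metis matrix_vector_mult_0_right)
  show ?thesis
  proof
    assume "(`) ((*v) g) ` {right_span u, right_span w} = {right_span u, right_span w}"
    then have "right_span (g *v u) \<in> {right_span u, right_span w}"
      by (auto simp: image_right_span)
    then have "g *v u \<in> right_span u \<or> g *v u \<in> right_span w"
      using right_span_base [of "g *v u"] by auto
    then show "qinner u (g *v u) = 0 \<or> qinner w (g *v u) = 0"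
      by (auto simp: mem)
  next
    assume "qinner u (g *v u) = 0 \<or> qinner w (g *v u) = 0"
    then consider "right_span (g *v u) = right_span w" | "right_span (g *v u) = right_span u"
      using mem nz right_span_eqI by blast
    then show "(`) ((*v) g) ` {right_span u, right_span w} = {right_span u, right_span w}"
    proof cases
      case 1
      with img compl(2) have "(*v) g ` right_span w = right_span u" by simp
      then show ?thesis using 1 by (simp add: image_right_span [of g u] insert_commute)
    next
      case 2
      with img compl(1) have "(*v) g ` right_span w = right_span w" by simp
      then show ?thesis using 2 by (simp add: image_right_span [of g u])
    qed
  qed
qed

section \<open>The orthogonal system given by a quaternion\<close>

lemma orthogonal_system_complements:
  "right_span (vector [- qcnj q, 1]) = orth_compl (right_span (vector [1, q]))"
  "right_span (vector [1, q]) = orth_compl (right_span (vector [- qcnj q, 1]))"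
proof -
  show "right_span (vector [- qcnj q, 1]) = orth_compl (right_span (vector [1, q]))"
    unfolding orth_compl_def by (rule right_span_orth_complement)
  have "w \<in> right_span (vector [1, q]) \<longleftrightarrow> qinner (vector [- qcnj q, 1]) w = 0" for w
  proof
    assume "w \<in> right_span (vector [1, q])"
    then show "qinner (vector [- qcnj q, 1]) w = 0"
      by (auto simp: right_span_def right_scale_def qinner_def sum_2 mult.assoc)
  next
    assume "qinner (vector [- qcnj q, 1]) w = 0"
    then have "w = right_scale (vector [1, q]) (w $ 1)"
      by (simp add: qinner_def sum_2 right_scale_def vec_eq_iff forall_2)
    then show "w \<in> right_span (vector [1, q])"
      unfolding right_span_def by blast
  qed
  then show "right_span (vector [1, q]) = orth_compl (right_span (vector [- qcnj q, 1]))"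
    unfolding set_eq_iff mem_orth_compl_right_span by blast
qed

lemma orthogonal_system_direct_sum:
  fixes q :: quat
  defines "V \<equiv> right_span (vector [1, q])" and "W \<equiv> right_span (vector [- qcnj q, 1])"
  shows "one_dim V" "one_dim W" "V \<inter> W = {0}" "{v + w | v w. v \<in> V \<and> w \<in> W} = UNIV"
proof -
  define N where "N = 1 + ((qre q)\<^sup>2 + (qi q)\<^sup>2 + (qj q)\<^sup>2 + (qk q)\<^sup>2)"
  have "N > 0" unfolding N_def by (smt (verit) zero_le_power2)
  have nq: "qcnj q * q = (N - 1) *\<^sub>R 1" "q * qcnj q = (N - 1) *\<^sub>R 1"
    by (simp_all add: N_def qcnj_mult_self mult_qcnj_self)
  show "one_dim V" "one_dim W"
    unfolding one_dim_def V_def W_def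
    by (rule exI, rule conjI [OF _ refl], simp add: vec_eq_iff forall_2)+
  show "V \<inter> W = {0}"
  proof (intro subset_antisym subsetI)
    fix x assume "x \<in> V \<inter> W"
    then have "x \<in> range (right_scale (vector [1, q]))"
        "x \<in> range (right_scale (vector [- qcnj q, 1]))"
      by (simp_all add: V_def W_def right_span_def)
    then obtain s t where x: "x = right_scale (vector [1, q]) s"
        "x = right_scale (vector [- qcnj q, 1]) t"
      by blast
    have eqs: "x $ 1 = s" "x $ 2 = q * s"
      unfolding x(1) by (simp_all add: right_scale_def)
    have "x $ 1 = - (qcnj q * x $ 2)"
      unfolding x(2) by (simp add: right_scale_def)
    then have "s = - (qcnj q * q * s)" by (simp add: eqs mult.assoc)
    then have "N *\<^sub>R s = 0" by (simp add: nq algebra_simps)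
    with \<open>N > 0\<close> have "s = 0" by simp
    with eqs show "x \<in> {0}" by (simp add: vec_eq_iff forall_2)
  next
    fix x :: "quat^2" assume "x \<in> {0}"
    then have "x = right_scale (vector [1, q]) 0" "x = right_scale (vector [- qcnj q, 1]) 0"
      by (simp_all add: right_scale_def vec_eq_iff)
    then show "x \<in> V \<inter> W" unfolding V_def W_def right_span_def by blast
  qed
  have "\<exists>v w. x = v + w \<and> v \<in> V \<and> w \<in> W" for x
  proof -
    \<comment> \<open>The coefficients of the orthogonal projections of \<open>x\<close>: both spanning vectors have
      squared length \<open>N\<close>.\<close>
    define s where "s = inverse N *\<^sub>R (x $ 1 + qcnj q * x $ 2)"
    define t where "t = inverse N *\<^sub>R (x $ 2 - q * x $ 1)"
    have N: "N *\<^sub>R s = x $ 1 + qcnj q * x $ 2" "N *\<^sub>R t = x $ 2 - q * x $ 1"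
      using \<open>N > 0\<close> unfolding s_def t_def by simp_all
    have "N *\<^sub>R (s - qcnj q * t) = x $ 1 + qcnj q * x $ 2 - qcnj q * (x $ 2 - q * x $ 1)"
      by (simp only: scaleR_diff_right N flip: mult_scaleR_right)
    also have "\<dots> = x $ 1 + (qcnj q * q) * x $ 1"
      by (simp add: algebra_simps)
    also have "\<dots> = N *\<^sub>R x $ 1"
      by (simp add: nq algebra_simps)
    finally have 1: "x $ 1 = s - qcnj q * t"
      using \<open>N > 0\<close> by simp
    have "N *\<^sub>R (q * s + t) = q * (x $ 1 + qcnj q * x $ 2) + (x $ 2 - q * x $ 1)"
      by (simp only: scaleR_add_right N flip: mult_scaleR_right)
    also have "\<dots> = (q * qcnj q) * x $ 2 + x $ 2"
      by (simp add: algebra_simps)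
    also have "\<dots> = N *\<^sub>R x $ 2"
      by (simp add: nq algebra_simps)
    finally have 2: "x $ 2 = q * s + t"
      using \<open>N > 0\<close> by simp
    have "x = right_scale (vector [1, q]) s + right_scale (vector [- qcnj q, 1]) t"
      by (simp add: vec_eq_iff forall_2 right_scale_def 1 2)
    then show ?thesis
      unfolding V_def W_def right_span_def by blast
  qed
  then show "{v + w | v w. v \<in> V \<and> w \<in> W} = UNIV" by blast
qed

lemma equations_iff_orthogonality:
  fixes a b c d q :: quat
  defines "g \<equiv> (vector [vector [a, b], vector [c, d]] :: quat^2^2)"
  shows "a + b * q + qcnj q * c + qcnj q * d * q = 0 \<longleftrightarrow>
           qinner (vector [1, q]) (g *v vector [1, q]) = 0"
    and "q * a + q * b * q - c - d * q = 0 \<longleftrightarrow>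
           qinner (vector [- qcnj q, 1]) (g *v vector [1, q]) = 0"
proof -
  have gv: "(g *v vector [1, q]) $ 1 = a + b * q" "(g *v vector [1, q]) $ 2 = c + d * q"
    by (simp_all add: g_def matrix_vector_mult_def sum_2)
  have "qinner (vector [1, q]) (g *v vector [1, q]) = a + b * q + qcnj q * c + qcnj q * d * q"
    by (simp add: qinner_def sum_2 gv algebra_simps)
  then show "a + b * q + qcnj q * c + qcnj q * d * q = 0 \<longleftrightarrow>
      qinner (vector [1, q]) (g *v vector [1, q]) = 0" by simp
  have "qinner (vector [- qcnj q, 1]) (g *v vector [1, q]) = - (q * a + q * b * q - c - d * q)"
    by (simp add: qinner_def sum_2 gv algebra_simps)
  then show "q * a + q * b * q - c - d * q = 0 \<longleftrightarrow>
      qinner (vector [- qcnj q, 1]) (g *v vector [1, q]) = 0"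
    by (simp only: neg_equal_0_iff_equal)
qed

section \<open>From generators to the group\<close>

text \<open>Matrices act on families of subsets by taking images twice, and this is an action of the
  multiplicative monoid of matrices; hence the matrices fixing \<open>P\<close> are closed under products and
  under inverses.\<close>

lemma generate_permutes:
  fixes P :: "(quat^2) set set"
  assumes grp: "group (GL2 F)" and sub: "S \<subseteq> carrier (GL2 F)"
    and S: "\<And>g. g \<in> S \<Longrightarrow> (`) ((*v) g) ` P = P"
    and g: "g \<in> generate (GL2 F) S"
  shows "(`) ((*v) g) ` P = P"
proof -
  have mult: "(`) ((*v) (A ** B)) ` P = (`) ((*v) A) ` (`) ((*v) B) ` P" for A B :: "quat^2^2"
    by (simp add: image_image matrix_vector_mul_assoc)
  have one: "(`) ((*v) (mat 1 :: quat^2^2)) ` P = P"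
    by simp
  show ?thesis
    using g
  proof induction
    case one
    then show ?case by (simp add: GL2_def)
  next
    case (incl g)
    then show ?case by (rule S)
  next
    case (inv g)
    have "inv\<^bsub>GL2 F\<^esub> g ** g = mat 1"
      using group.l_inv [OF grp subsetD [OF sub inv]] by (simp add: GL2_def)
    then show ?case
      using mult [of "inv\<^bsub>GL2 F\<^esub> g" g] S [OF inv] one by simp
  next
    case (eng g h)
    then show ?case by (simp add: GL2_def mult)
  qed
qed

section \<open>The criterion\<close>

theorem lemma2p1:
  fixes F :: "quat set" and G S :: "(quat^2^2) set" and q :: quat
  assumes "F \<in> {\<real>, range quat_of_complex, UNIV}"
    and "subgroup G (GL2 F)"
    and "\<forall>g\<in>G. unitary g"
    and "S \<subseteq> G" and "generate (GL2 F) S = G"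
  shows "system_of_imprimitivity G
           (right_span (vector [1, q])) (right_span (vector [- qcnj q, 1])) \<longleftrightarrow>
         (\<forall>a b c d. vector [vector [a, b], vector [c, d]] \<in> S \<longrightarrow>
            a + b * q + qcnj q * c + qcnj q * d * q = 0 \<or>
            q * a + q * b * q - c - d * q = 0)"
proof -
  let ?v = "vector [1, q] :: quat^2" and ?w = "vector [- qcnj q, 1] :: quat^2"
  let ?P = "{right_span ?v, right_span ?w}"
  have GL: "G \<subseteq> carrier (GL2 F)" using assms(2) by (rule subgroup.subset)
  have "system_of_imprimitivity G (right_span ?v) (right_span ?w) \<longleftrightarrow>
      (\<forall>g\<in>G. (`) ((*v) g) ` ?P = ?P)"
    unfolding system_of_imprimitivity_def
    by (simp only: orthogonal_system_direct_sum image_insert image_empty simp_thms)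
  also have "\<dots> \<longleftrightarrow> (\<forall>g\<in>S. (`) ((*v) g) ` ?P = ?P)"
  proof
    assume "\<forall>g\<in>G. (`) ((*v) g) ` ?P = ?P"
    then show "\<forall>g\<in>S. (`) ((*v) g) ` ?P = ?P" using assms(4) by (meson subsetD)
  next
    assume "\<forall>g\<in>S. (`) ((*v) g) ` ?P = ?P"
    then show "\<forall>g\<in>G. (`) ((*v) g) ` ?P = ?P"
      using generate_permutes [OF group_GL2 [OF assms(1)] subset_trans [OF assms(4) GL]]
      unfolding assms(5) by (metis (no_types, lifting))
  qed
  also have "\<dots> \<longleftrightarrow> (\<forall>g\<in>S. qinner ?v (g *v ?v) = 0 \<or> qinner ?w (g *v ?v) = 0)"
  proof (intro ball_cong refl)
    fix g assume "g \<in> S"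
    then have "unitary g" "g \<in> carrier (GL2 F)" using assms(3,4) GL by blast+
    then obtain h where "unitary g" "g ** h = mat 1" "h ** g = mat 1"
      by (auto simp: GL2_def)
    moreover have "?v \<noteq> 0" by (simp add: vec_eq_iff forall_2)
    ultimately show "(`) ((*v) g) ` ?P = ?P \<longleftrightarrow>
        qinner ?v (g *v ?v) = 0 \<or> qinner ?w (g *v ?v) = 0"
      using orthogonal_system_complements by (rule unitary_permutes_orthogonal_pair_iff)
  qed
  also have "\<dots> \<longleftrightarrow> (\<forall>a b c d. vector [vector [a, b], vector [c, d]] \<in> S \<longrightarrow>
      a + b * q + qcnj q * c + qcnj q * d * q = 0 \<or> q * a + q * b * q - c - d * q = 0)"
  proof -
    have "g = vector [vector [g $ 1 $ 1, g $ 1 $ 2], vector [g $ 2 $ 1, g $ 2 $ 2]]"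
      for g :: "quat^2^2"
      by (simp add: vec_eq_iff forall_2)
    then show ?thesis
      unfolding equations_iff_orthogonality by metis
  qed
  finally show ?thesis .
qed

end
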